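(* Let $\mu,\alpha,\beta,\gamma\ge0$ and let $\mathcal{R}_2$ be the set of all $\mathbf{Y}\in\mathbb{R}^{p\times r}_*$ with $$d([\mathbf{Y}],[\mathbf{Y}^*])>\mu\sigma_r(\mathbf{Y}^* )/\kappa^*,\quad\|\overline{\mathrm{grad}\,H([\mathbf{Y}])}\|_F\le\alpha\mu\sigma_r^3(\mathbf{Y}^* )/(4\kappa^* ),\quad\|\mathbf{Y}\|\le\beta\|\mathbf{Y}^*\|,\quad\|\mathbf{Y}\mathbf{Y}^\top\|_F\le\gamma\|\mathbf{Y}^*\mathbf{Y}^{*\top}\|_F .$$ Given any $\mathbf{Y}\in\mathcal{R}_2$, let $\theta_{\mathbf{Y}}=\mathbf{Y}-\mathbf{Y}^*\mathbf{Q}$, where $\mathbf{Q}\in\arg\min_{\mathbf{O}\in\mathbb{O}_r}\|\mathbf{Y}^*\mathbf{O}-\mathbf{Y}\|_F$. Then $$\overline{\mathrm{Hess}\,H([\mathbf{Y}])}[\theta_{\mathbf{Y}},\theta_{\mathbf{Y}}]\le\big(\alpha-2(\sqrt2-1)\big)\sigma_r^2(\mathbf{Y}^* )\|\theta_{\mathbf{Y}}\|_F^2 .$$ In particular, if $\alpha<2(\sqrt2-1)$, then $\overline{\mathrm{Hess}\,H([\mathbf{Y}])}$ has at least one negative eigenvalue and $\theta_{\mathbf{Y}}$ is an escaping direction (a direction of negative curvature).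
   Context: Let $0<r\le p$ be integers. $\|\cdot\|$, $\|\cdot\|_F$ are the spectral and Frobenius norms and $\sigma_i(\cdot)$ the $i$-th largest singular value. $\mathbb{R}^{p\times r}_*$ is the set of real $p\times r$ matrices of full column rank, $\mathbb{O}_r$ the orthogonal group, and $\mathcal{M}=\mathbb{R}^{p\times r}_*/\mathbb{O}_r$ the quotient manifold with points $[\mathbf{Y}]=\{\mathbf{Y}\mathbf{O}:\mathbf{O}\in\mathbb{O}_r\}$ and the Riemannian metric induced from $\mathrm{tr}(\eta^\top\theta)$; tangent vectors at $[\mathbf{Y}]$ are represented by horizontal lifts in $\mathcal{H}_{\mathbf{Y}}=\{\theta\in\mathbb{R}^{p\times r}:\mathbf{Y}^\top\theta\text{ symmetric}\}$, and $d([\mathbf{Y}_1],[\mathbf{Y}_2])=\min_{\mathbf{Q}\in\mathbb{O}_r}\|\mathbf{Y}_2\mathbf{Q}-\mathbf{Y}_1\|_F$ is the geodesic distance. $\mathbf{X}^*=\mathbf{Y}^*\mathbf{Y}^{*\top}$ is a symmetric positive semidefinite $p\times p$ matrix of rank $r$, with $\mathbf{Y}^*\in\mathbb{R}^{p\times r}_*$ and $\kappa^*=\sigma_1(\mathbf{Y}^* )/\sigma_r(\mathbf{Y}^* )$. $H([\mathbf{Y}])=\frac12\|\mathbf{Y}\mathbf{Y}^\top-\mathbf{X}^*\|_F^2$ on $\mathcal{M}$, with lifted Riemannian gradient $\overline{\mathrm{grad}\,H([\mathbf{Y}])}=2(\mathbf{Y}\mathbf{Y}^\top-\mathbf{X}^*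 )\mathbf{Y}$ and lifted Riemannian Hessian $\overline{\mathrm{Hess}\,H([\mathbf{Y}])}[\theta,\theta]=\|\mathbf{Y}\theta^\top+\theta\mathbf{Y}^\top\|_F^2+2\langle\mathbf{Y}\mathbf{Y}^\top-\mathbf{X}^*,\theta\theta^\top\rangle$ for $\theta\in\mathcal{H}_{\mathbf{Y}}$. *)

theory Defs
  imports "HOL-Analysis.Analysis" "HOL-Library.Multiset"
begin

text \<open>
  A real \<open>p \<times> r\<close> matrix is an element of \<open>real ^ 'r ^ 'p\<close>, with \<open>p = CARD('p)\<close> and
  \<open>r = CARD('r)\<close>. On this type, the library inner product is \<open>tr (A\<^sup>T B)\<close> and \<open>norm\<close> is
  the Frobenius norm (the two lemmas below). The spectral norm of \<open>A\<close> is \<open>onorm ((*v) A)\<close>.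
\<close>

lemma inner_matrix_trace: "A \<bullet> B = trace (transpose A ** B)"
  for A B :: "real ^ 'r::finite ^ 'p::finite"
  unfolding inner_vec_def trace_def matrix_matrix_mult_def transpose_def
  by (simp add: sum.swap[of _ "UNIV::'p set"])

lemma norm_matrix_Frobenius: "norm A = sqrt (\<Sum>i\<in>UNIV. \<Sum>j\<in>UNIV. (A $ i $ j)\<^sup>2)"
  for A :: "real ^ 'r::finite ^ 'p::finite"
  unfolding norm_eq_sqrt_inner by (simp add: inner_vec_def power2_eq_square)


section \<open>Singular values\<close>

definition eigvals :: "real ^ 'n::finite ^ 'n \<Rightarrow> real set" where
  "eigvals A = {l. \<exists>v. v \<noteq> 0 \<and> A *v v = l *\<^sub>R v}"

text \<open>Geometric multiplicities; \<open>eigval_mset\<close> is only meant for symmetric matrices.\<close>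

definition eigval_mset :: "real ^ 'n::finite ^ 'n \<Rightarrow> real multiset" where
  "eigval_mset A = (\<Sum>l\<in>eigvals A. replicate_mset (dim {v. A *v v = l *\<^sub>R v}) l)"

text \<open>
  The \<open>i\<close>-th largest singular value, \<open>1 \<le> i \<le> r\<close>, counted with multiplicity: the square root
  of the \<open>i\<close>-th largest eigenvalue of \<open>A\<^sup>T A\<close>.
\<close>

definition sing_val :: "nat \<Rightarrow> real ^ 'r::finite ^ 'p::finite \<Rightarrow> real" where
  "sing_val i A = sqrt (rev (sorted_list_of_multiset (eigval_mset (transpose A ** A))) ! (i - 1))"

definition sing_val_min :: "real ^ 'r::finite ^ 'p::finite \<Rightarrow> real" where
  "sing_val_min A = sing_val (CARD('r)) A"

definition cond_num :: "real ^ 'r::finite ^ 'p::finite \<Rightarrow> real" where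
  "cond_num A = sing_val 1 A / sing_val_min A"


section \<open>The quotient of full column rank matrices by the orthogonal group\<close>

definition full_col_rank :: "(real ^ 'r::finite ^ 'p::finite) set" where
  "full_col_rank = {Y. rank Y = CARD('r)}"

definition quot_class :: "real ^ 'r::finite ^ 'p::finite \<Rightarrow> (real ^ 'r ^ 'p) set" where
  "quot_class Y = {Y ** Q | Q. orthogonal_matrix Q}"

definition rep :: "(real ^ 'r::finite ^ 'p::finite) set \<Rightarrow> real ^ 'r ^ 'p" where
  "rep C = (SOME Y. Y \<in> C)"

text \<open>
  Functions of points of the quotient are defined through a representative; independence of
  the representative is proved in \<open>quot_dist_class\<close> and \<open>H_fun_class\<close>.
\<close>

definition quot_dist ::
  "(real ^ 'r::finite ^ 'p::finite) set \<Rightarrow> (real ^ 'r ^ 'p) set \<Rightarrow> real" where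
  "quot_dist C1 C2 = (INF Q\<in>{Q. orthogonal_matrix Q}. norm (rep C2 ** Q - rep C1))"

definition horizontal :: "real ^ 'r::finite ^ 'p::finite \<Rightarrow> (real ^ 'r ^ 'p) set" where
  "horizontal Y = {\<theta>. transpose (transpose Y ** \<theta>) = transpose Y ** \<theta>}"

text \<open>
  Riemannian gradient and Hessian of a function \<open>f\<close> on the quotient, both given by their
  horizontal lifts at \<open>Y\<close>. Since the quotient map is a Riemannian submersion from an open
  subset of a Euclidean space, the lift of the covariant derivative of a vector field is the
  horizontal projection of the Euclidean derivative of its horizontal lift; the
  Hessian is this covariant derivative of the gradient field. \<open>closest_point (horizontal Y)\<close> is
  the orthogonal projection onto the horizontal space.
\<close>

definition lifted_grad ::
  "((real ^ 'r::finite ^ 'p::finite) set \<Rightarrow> real) \<Rightarrow> real ^ 'r ^ 'p \<Rightarrow> real ^ 'r ^ 'p" where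
  "lifted_grad f Y = (THE G. G \<in> horizontal Y \<and>
     ((\<lambda>Z. f (quot_class Z)) has_derivative (\<lambda>\<theta>. G \<bullet> \<theta>)) (at Y))"

definition lifted_hess ::
  "((real ^ 'r::finite ^ 'p::finite) set \<Rightarrow> real) \<Rightarrow> real ^ 'r ^ 'p \<Rightarrow> real ^ 'r ^ 'p \<Rightarrow> real ^ 'r ^ 'p"
where
  "lifted_hess f Y \<theta> =
     closest_point (horizontal Y) (frechet_derivative (lifted_grad f) (at Y) \<theta>)"

definition hess_form ::
  "((real ^ 'r::finite ^ 'p::finite) set \<Rightarrow> real) \<Rightarrow> real ^ 'r ^ 'p \<Rightarrow> real ^ 'r ^ 'p \<Rightarrow> real ^ 'r ^ 'p \<Rightarrow> real"
where
  "hess_form f Y \<theta> \<eta> = lifted_hess f Y \<theta> \<bullet> \<eta>"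

definition hess_eigenvalue ::
  "((real ^ 'r::finite ^ 'p::finite) set \<Rightarrow> real) \<Rightarrow> real ^ 'r ^ 'p \<Rightarrow> real \<Rightarrow> bool" where
  "hess_eigenvalue f Y l \<longleftrightarrow> (\<exists>\<theta>\<in>horizontal Y. \<theta> \<noteq> 0 \<and> lifted_hess f Y \<theta> = l *\<^sub>R \<theta>)"

definition escaping_direction ::
  "((real ^ 'r::finite ^ 'p::finite) set \<Rightarrow> real) \<Rightarrow> real ^ 'r ^ 'p \<Rightarrow> real ^ 'r ^ 'p \<Rightarrow> bool" where
  "escaping_direction f Y \<theta> \<longleftrightarrow> \<theta> \<in> horizontal Y \<and> hess_form f Y \<theta> \<theta> < 0"


section \<open>The objective and the region\<close>

definition H_fun :: "real ^ 'p::finite ^ 'p \<Rightarrow> (real ^ 'r::finite ^ 'p) set \<Rightarrow> real" where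
  "H_fun X C = (norm (rep C ** transpose (rep C) - X))\<^sup>2 / 2"

definition region_R2 ::
  "real \<Rightarrow> real \<Rightarrow> real \<Rightarrow> real \<Rightarrow> real ^ 'r::finite ^ 'p::finite \<Rightarrow> (real ^ 'r ^ 'p) set" where
  "region_R2 \<mu> \<alpha> \<beta> \<gamma> Ys = {Y \<in> full_col_rank.
     quot_dist (quot_class Y) (quot_class Ys) > \<mu> * sing_val_min Ys / cond_num Ys \<and>
     norm (lifted_grad (H_fun (Ys ** transpose Ys)) Y)
       \<le> \<alpha> * \<mu> * sing_val_min Ys ^ 3 / (4 * cond_num Ys) \<and>
     onorm ((*v) Y) \<le> \<beta> * onorm ((*v) Ys) \<and>
     norm (Y ** transpose Y) \<le> \<gamma> * norm (Ys ** transpose Ys)}"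


section \<open>Independence of representatives\<close>

lemma rep_quot_class:
  fixes Y :: "real ^ 'r::finite ^ 'p::finite"
  obtains Q where "orthogonal_matrix Q" "rep (quot_class Y) = Y ** Q"
proof -
  have "Y ** mat 1 \<in> quot_class Y"
    unfolding quot_class_def using orthogonal_matrix_id by blast
  then have "rep (quot_class Y) \<in> quot_class Y"
    unfolding rep_def by (rule someI)
  then show ?thesis using that unfolding quot_class_def by blast
qed

lemma inner_matrix_mult_right: "(A ** B) \<bullet> C = A \<bullet> (C ** transpose B)"
  for A :: "real ^ 'n::finite ^ 'm::finite" and B :: "real ^ 'k::finite ^ 'n"
proof -
  have "(A ** B) \<bullet> C = (\<Sum>i\<in>UNIV. \<Sum>j\<in>UNIV. \<Sum>k\<in>UNIV. A $ i $ k * B $ k $ j * C $ i $ j)"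
    by (simp add: inner_vec_def matrix_matrix_mult_def sum_distrib_right)
  also have "\<dots> = (\<Sum>i\<in>UNIV. \<Sum>k\<in>UNIV. \<Sum>j\<in>UNIV. A $ i $ k * B $ k $ j * C $ i $ j)"
    by (intro sum.cong refl sum.swap)
  also have "\<dots> = A \<bullet> (C ** transpose B)"
    by (simp add: inner_vec_def matrix_matrix_mult_def transpose_def sum_distrib_left mult_ac)
  finally show ?thesis .
qed

lemma inner_transpose_transpose: "transpose A \<bullet> transpose B = A \<bullet> B"
  for A B :: "real ^ 'n::finite ^ 'm::finite"
  by (simp add: inner_vec_def transpose_def sum.swap[of _ "UNIV::'n set"])

lemma norm_mult_orthogonal: "norm (A ** Q) = norm A" if "orthogonal_matrix Q"
  for A :: "real ^ 'n::finite ^ 'm::finite"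
  using that
  by (simp add: norm_eq_sqrt_inner inner_matrix_mult_right orthogonal_matrix_def
      flip: matrix_mul_assoc)

lemma matrix_diff_distribs:
  fixes A A' :: "real ^ 'n::finite ^ 'm::finite" and B B' :: "real ^ 'k::finite ^ 'n"
  shows "(A - A') ** B = A ** B - A' ** B" "A ** (B - B') = A ** B - A ** B'"
  by (simp_all add: vec_eq_iff matrix_matrix_mult_def algebra_simps sum_subtractf)

lemma quot_dist_class:
  fixes Y1 Y2 :: "real ^ 'r::finite ^ 'p::finite"
  shows "quot_dist (quot_class Y1) (quot_class Y2)
     = (INF Q\<in>{Q. orthogonal_matrix Q}. norm (Y2 ** Q - Y1))"
proof -
  obtain P1 where P1: "orthogonal_matrix P1" "rep (quot_class Y1) = Y1 ** P1"
    by (rule rep_quot_class)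
  obtain P2 where P2: "orthogonal_matrix P2" "rep (quot_class Y2) = Y2 ** P2"
    by (rule rep_quot_class)
  define g :: "real ^ 'r ^ 'r \<Rightarrow> real ^ 'r ^ 'r" where "g = (\<lambda>Q. P2 ** Q ** transpose P1)"
  have eq: "norm (Y2 ** P2 ** Q - Y1 ** P1) = norm (Y2 ** g Q - Y1)" for Q
  proof -
    have "Y2 ** P2 ** Q - Y1 ** P1 = (Y2 ** g Q - Y1) ** P1"
      using P1(1) unfolding g_def orthogonal_matrix_def
      by (simp add: matrix_diff_distribs flip: matrix_mul_assoc)
    then show ?thesis by (simp add: norm_mult_orthogonal P1(1))
  qed
  have "g ` {Q. orthogonal_matrix Q} = {Q. orthogonal_matrix Q}"
  proof (intro equalityI subsetI)
    fix R assume R: "(R :: real ^ 'r ^ 'r) \<in> {Q. orthogonal_matrix Q}"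
    have "R = g (transpose P2 ** R ** P1)"
      using P1(1) P2(1) unfolding g_def orthogonal_matrix_def
      by (metis matrix_mul_assoc matrix_mul_lid matrix_mul_rid)
    moreover have "orthogonal_matrix (transpose P2 ** R ** P1)"
      using R P1(1) P2(1) by (simp add: orthogonal_matrix_mul)
    ultimately show "R \<in> g ` {Q. orthogonal_matrix Q}" by blast
  qed (auto simp: g_def P1(1) P2(1) orthogonal_matrix_mul)
  then show ?thesis
    unfolding quot_dist_def P1(2) P2(2) eq
    using image_image[of "\<lambda>Q. norm (Y2 ** Q - Y1)" g "{Q. orthogonal_matrix Q}"] by (simp only:)
qed

lemma bounded_bilinear_matrix_mult:
  "bounded_bilinear ((**) :: real ^ 'n::finite ^ 'm::finite \<Rightarrow> real ^ 'k::finite ^ 'n \<Rightarrow> real ^ 'k ^ 'm)"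
  unfolding bilinear_conv_bounded_bilinear[symmetric] bilinear_def
  by (intro conjI allI linearI)
    (simp_all add: vec_eq_iff matrix_matrix_mult_def algebra_simps sum.distrib sum_distrib_left)

lemma linear_transpose: "linear (transpose :: real ^ 'n::finite ^ 'm::finite \<Rightarrow> _)"
  by (intro linearI) (simp_all add: vec_eq_iff transpose_def)

lemma compact_orthogonal_matrices: "compact {Q :: real ^ 'n::finite ^ 'n. orthogonal_matrix Q}"
proof -
  have "continuous_on UNIV (\<lambda>Q :: real ^ 'n ^ 'n. transpose Q ** Q)"
    by (intro bounded_bilinear.continuous_on[OF bounded_bilinear_matrix_mult]
        linear_continuous_on continuous_on_id)
      (simp add: linear_transpose flip: linear_conv_bounded_linear)
  then have "closed ((\<lambda>Q :: real ^ 'n ^ 'n. transpose Q ** Q) -` {mat 1} \<inter> UNIV)"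
    by (subst (asm) continuous_on_closed_vimage) auto
  moreover have "(\<lambda>Q :: real ^ 'n ^ 'n. transpose Q ** Q) -` {mat 1} \<inter> UNIV
      = {Q. orthogonal_matrix Q}"
    by (auto simp: orthogonal_matrix)
  moreover have "bounded {Q :: real ^ 'n ^ 'n. orthogonal_matrix Q}"
    unfolding bounded_iff
  proof (intro exI ballI)
    fix Q :: "real ^ 'n ^ 'n" assume "Q \<in> {Q. orthogonal_matrix Q}"
    then show "norm Q \<le> norm (mat 1 :: real ^ 'n ^ 'n)"
      by (metis matrix_mul_lid mem_Collect_eq norm_mult_orthogonal order_refl)
  qed
  ultimately show ?thesis by (simp add: compact_eq_bounded_closed)
qed

text \<open>The infimum in \<open>quot_dist_class\<close> is a minimum.\<close>

lemma quot_dist_attained: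
  fixes Y1 Y2 :: "real ^ 'r::finite ^ 'p::finite"
  obtains Q where "orthogonal_matrix Q"
    "quot_dist (quot_class Y1) (quot_class Y2) = norm (Y2 ** Q - Y1)"
    "\<And>R. orthogonal_matrix R \<Longrightarrow> norm (Y2 ** Q - Y1) \<le> norm (Y2 ** R - Y1)"
proof -
  let ?O = "{Q :: real ^ 'r ^ 'r. orthogonal_matrix Q}"
  have "continuous_on ?O (\<lambda>Q. norm (Y2 ** Q - Y1))"
    by (intro continuous_intros
        bounded_bilinear.continuous_on[OF bounded_bilinear_matrix_mult])
  moreover have "?O \<noteq> {}" using orthogonal_matrix_id by blast
  ultimately obtain Q where Q: "Q \<in> ?O" "\<forall>R\<in>?O. norm (Y2 ** Q - Y1) \<le> norm (Y2 ** R - Y1)"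
    using continuous_attains_inf[OF compact_orthogonal_matrices] by blast
  have "(INF R\<in>?O. norm (Y2 ** R - Y1)) = norm (Y2 ** Q - Y1)"
    using Q by (intro cInf_eq_minimum) auto
  then show ?thesis using Q by (intro that[of Q]) (auto simp: quot_dist_class)
qed

lemma H_fun_class: "H_fun X (quot_class Y) = (norm (Y ** transpose Y - X))\<^sup>2 / 2"
proof -
  obtain P where P: "orthogonal_matrix P" "rep (quot_class Y) = Y ** P"
    by (rule rep_quot_class)
  then have "rep (quot_class Y) ** transpose (rep (quot_class Y)) = Y ** transpose Y"
    unfolding orthogonal_matrix_def by (metis matrix_mul_assoc matrix_mul_rid matrix_transpose_mul)
  then show ?thesis unfolding H_fun_def by simp
qed


section \<open>Closed forms of the gradient and the Hessian of \<open>H_fun\<close>\<close>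

lemma has_derivative_gram:
  "((\<lambda>Z. Z ** transpose Z) has_derivative (\<lambda>\<theta>. Y ** transpose \<theta> + \<theta> ** transpose Y)) (at Y)"
  for Y :: "real ^ 'r::finite ^ 'p::finite"
  by (intro bounded_bilinear.FDERIV[OF bounded_bilinear_matrix_mult]
      bounded_linear_imp_has_derivative has_derivative_ident)
    (simp add: linear_transpose flip: linear_conv_bounded_linear)

lemma transpose_diff: "transpose (A - B) = transpose A - transpose B"
  for A B :: "real ^ 'n::finite ^ 'm::finite"
  by (simp add: vec_eq_iff transpose_def)

lemma inner_symmetrized:
  fixes S :: "real ^ 'p::finite ^ 'p" and Y \<theta> :: "real ^ 'r::finite ^ 'p"
  assumes "transpose S = S"
  shows "S \<bullet> (Y ** transpose \<theta> + \<theta> ** transpose Y) = 2 * ((S ** Y) \<bullet> \<theta>)"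
proof -
  have *: "S \<bullet> (\<theta> ** transpose Y) = (S ** Y) \<bullet> \<theta>"
    using inner_matrix_mult_right[of \<theta> "transpose Y" S] by (simp add: inner_commute)
  have "S \<bullet> (Y ** transpose \<theta>) = transpose S \<bullet> transpose (Y ** transpose \<theta>)"
    by (simp only: inner_transpose_transpose)
  also have "\<dots> = S \<bullet> (\<theta> ** transpose Y)" by (simp add: assms matrix_transpose_mul)
  finally show ?thesis by (simp add: inner_add_right *)
qed

lemma lifted_grad_H_fun:
  fixes Y :: "real ^ 'r::finite ^ 'p::finite"
  assumes X: "transpose X = X"
  shows "lifted_grad (H_fun X) Y = 2 *\<^sub>R ((Y ** transpose Y - X) ** Y)"
proof -
  define S where "S = Y ** transpose Y - X"
  have S: "transpose S = S" by (simp add: S_def transpose_diff matrix_transpose_mul X)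
  have "((\<lambda>Z. (Z ** transpose Z - X) \<bullet> (Z ** transpose Z - X)) has_derivative
      (\<lambda>\<theta>. S \<bullet> (Y ** transpose \<theta> + \<theta> ** transpose Y) + (Y ** transpose \<theta> + \<theta> ** transpose Y) \<bullet> S)) (at Y)"
    unfolding S_def
    by (rule derivative_eq_intros has_derivative_gram refl | simp)+
  from has_derivative_mult_right[OF this, of "1/2"]
  have D: "((\<lambda>Z. H_fun X (quot_class Z)) has_derivative (\<lambda>\<theta>. (2 *\<^sub>R (S ** Y)) \<bullet> \<theta>)) (at Y)"
    by (simp add: H_fun_class dot_square_norm inner_commute[of _ S] inner_symmetrized[OF S])
  have hor: "2 *\<^sub>R (S ** Y) \<in> horizontal Y"
  proof -
    have "transpose Y ** (2 *\<^sub>R (S ** Y)) = 2 *\<^sub>R (transpose Y ** (S ** Y))"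
      by (simp add: bounded_bilinear.scaleR_right[OF bounded_bilinear_matrix_mult])
    moreover have "transpose (transpose Y ** (S ** Y)) = transpose Y ** (S ** Y)"
      by (simp add: matrix_transpose_mul S matrix_mul_assoc)
    ultimately show ?thesis
      unfolding horizontal_def by (simp only: mem_Collect_eq linear_cmul[OF linear_transpose])
  qed
  have "lifted_grad (H_fun X) Y = 2 *\<^sub>R (S ** Y)"
    unfolding lifted_grad_def
  proof (rule the_equality)
    fix G assume "G \<in> horizontal Y \<and>
      ((\<lambda>Z. H_fun X (quot_class Z)) has_derivative (\<lambda>\<theta>. G \<bullet> \<theta>)) (at Y)"
    then have "(\<lambda>\<theta>. G \<bullet> \<theta>) = (\<lambda>\<theta>. (2 *\<^sub>R (S ** Y)) \<bullet> \<theta>)"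
      using D has_derivative_unique by blast
    then show "G = 2 *\<^sub>R (S ** Y)" by (metis vector_eq_rdot)
  qed (use D hor in blast)
  then show ?thesis by (simp add: S_def)
qed

lemma subspace_horizontal: "subspace (horizontal Y)"
  unfolding subspace_def horizontal_def
  by (simp add: matrix_add_ldistrib linear_add[OF linear_transpose]
      linear_cmul[OF linear_transpose] bounded_bilinear.scaleR_right[OF bounded_bilinear_matrix_mult])
    (simp add: vec_eq_iff transpose_def matrix_matrix_mult_def)

lemma closest_point_subspace_inner:
  fixes V :: "'a::euclidean_space set"
  assumes V: "subspace V" and "\<theta> \<in> V"
  shows "closest_point V x \<bullet> \<theta> = x \<bullet> \<theta>"
proof -
  let ?c = "closest_point V x"
  have cl: "closed V" "convex V" "V \<noteq> {}"
    using V by (auto simp: closed_subspace subspace_imp_convex dest: subspace_0)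
  have c: "?c \<in> V" using cl by (simp add: closest_point_in_set)
  have "(x - ?c) \<bullet> (y - ?c) \<le> 0" if "y \<in> V" for y
    using closest_point_dot[OF cl(2,1) that] .
  from this[of "?c + \<theta>"] this[of "?c - \<theta>"] have "(x - ?c) \<bullet> \<theta> = 0"
    using c assms by (auto simp: subspace_add subspace_diff)
  then show ?thesis by (simp add: inner_diff_left)
qed

text \<open>The right-hand side is symmetric in \<open>\<theta>\<close> and \<open>\<eta>\<close> because \<open>X\<close> is symmetric.\<close>

lemma hess_form_H_fun:
  fixes Y :: "real ^ 'r::finite ^ 'p::finite"
  assumes X: "transpose X = X" and \<eta>: "\<eta> \<in> horizontal Y"
  shows "hess_form (H_fun X) Y \<theta> \<eta> =
    (Y ** transpose \<theta> + \<theta> ** transpose Y) \<bullet> (Y ** transpose \<eta> + \<eta> ** transpose Y)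
    + 2 * ((Y ** transpose Y - X) \<bullet> (\<theta> ** transpose \<eta>))"
proof -
  define S where "S = Y ** transpose Y - X"
  define T where "T = Y ** transpose \<theta> + \<theta> ** transpose Y"
  have T: "transpose T = T"
    by (simp add: T_def linear_add[OF linear_transpose] matrix_transpose_mul add.commute)
  have "((\<lambda>Z. Z ** transpose Z - X) has_derivative
      (\<lambda>\<theta>. Y ** transpose \<theta> + \<theta> ** transpose Y)) (at Y)"
    by (rule derivative_eq_intros has_derivative_gram refl | simp)+
  note D2 = has_derivative_scaleR_right[OF
      bounded_bilinear.FDERIV[OF bounded_bilinear_matrix_mult this has_derivative_ident], of 2]
  have "lifted_grad (H_fun X) = (\<lambda>Z :: real ^ 'r ^ 'p. 2 *\<^sub>R ((Z ** transpose Z - X) ** Z))"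
    by (rule ext) (rule lifted_grad_H_fun[OF X])
  with D2 have "(lifted_grad (H_fun X) has_derivative
      (\<lambda>\<theta>. 2 *\<^sub>R (S ** \<theta> + (Y ** transpose \<theta> + \<theta> ** transpose Y) ** Y))) (at Y)"
    by (simp only: S_def)
  from frechet_derivative_at[OF this, symmetric]
  have D: "frechet_derivative (lifted_grad (H_fun X)) (at Y) \<theta> = 2 *\<^sub>R (S ** \<theta> + T ** Y)"
    by (simp only: T_def)
  have "hess_form (H_fun X) Y \<theta> \<eta> = 2 * ((T ** Y) \<bullet> \<eta>) + 2 * ((S ** \<theta>) \<bullet> \<eta>)"
    unfolding hess_form_def lifted_hess_def D
    by (simp add: closest_point_subspace_inner[OF subspace_horizontal \<eta>] inner_add_left)
  also have "2 * ((T ** Y) \<bullet> \<eta>) = T \<bullet> (Y ** transpose \<eta> + \<eta> ** transpose Y)"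
    by (rule inner_symmetrized[OF T, symmetric])
  also have "(S ** \<theta>) \<bullet> \<eta> = S \<bullet> (\<theta> ** transpose \<eta>)"
  proof -
    have St: "transpose S = S" by (simp add: S_def transpose_diff matrix_transpose_mul X)
    have "S \<bullet> (\<theta> ** transpose \<eta>) = transpose S \<bullet> transpose (\<theta> ** transpose \<eta>)"
      by (simp only: inner_transpose_transpose)
    also have "\<dots> = (S ** \<theta>) \<bullet> \<eta>"
      by (simp add: St matrix_transpose_mul inner_matrix_mult_right)
    finally show ?thesis by simp
  qed
  finally show ?thesis unfolding S_def T_def .
qed

corollary hess_form_H_fun_diag:
  fixes Y :: "real ^ 'r::finite ^ 'p::finite"
  assumes "transpose X = X" "\<theta> \<in> horizontal Y"
  shows "hess_form (H_fun X) Y \<theta> \<theta> = (norm (Y ** transpose \<theta> + \<theta> ** transpose Y))\<^sup>2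
    + 2 * ((Y ** transpose Y - X) \<bullet> (\<theta> ** transpose \<theta>))"
  by (simp add: hess_form_H_fun[OF assms] power2_norm_eq_inner)

end

theory Submission
  imports Defs
begin

text \<open>
  Put \<open>Z = Y\<^sup>* Q\<close>, so \<open>\<theta> = Y - Z\<close>, and let \<open>D = Y Y\<^sup>T - Z Z\<^sup>T\<close>. Testing the optimality of \<open>Q\<close>
  against a reflection and against products of two reflections shows that \<open>Z\<^sup>T Y\<close> is positive
  semidefinite and symmetric. Since \<open>Y \<theta>\<^sup>T + \<theta> Y\<^sup>T = D + \<theta> \<theta>\<^sup>T\<close>, the Hessian form at \<open>\<theta>\<close> equals
  \<open>4 \<langle>grad, \<theta>\<rangle> - 3 \<parallel>D\<parallel>\<^sup>2 + \<parallel>\<theta> \<theta>\<^sup>T\<parallel>\<^sup>2\<close>. With \<open>E = \<theta>\<^sup>T \<theta>\<close>, \<open>P = \<theta>\<^sup>T Z\<close> and \<open>B = Z\<^sup>T Z\<close>, so that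
  \<open>P + B = Z\<^sup>T Y\<close> and \<open>\<langle>E, P + B\<rangle> \<ge> 0\<close>, completing squares in
  \<open>\<parallel>D\<parallel>\<^sup>2 = \<parallel>E\<parallel>\<^sup>2 + 4 \<langle>E, P\<rangle> + 2 \<parallel>P\<parallel>\<^sup>2 + 2 \<langle>E, B\<rangle>\<close> gives
  \<open>2 \<parallel>D\<parallel>\<^sup>2 - \<parallel>E\<parallel>\<^sup>2 = \<parallel>E + 2 P\<parallel>\<^sup>2 + 4 \<langle>E, P + B\<rangle> \<ge> 0\<close> and
  \<open>\<parallel>D\<parallel>\<^sup>2 = \<parallel>E + \<surd>2 P\<parallel>\<^sup>2 + (4 - 2 \<surd>2) \<langle>E, P + B\<rangle> + 2 (\<surd>2 - 1) \<langle>E, B\<rangle> \<ge> 2 (\<surd>2 - 1) \<sigma>\<^sub>r\<^sup>2 \<parallel>\<theta>\<parallel>\<^sup>2\<close>.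
  The gradient term is absorbed because \<open>\<parallel>\<theta>\<parallel>\<close> is the quotient distance. A minimizer of the Rayleigh
  quotient on the horizontal space yields the negative eigenvalue; the same principle shows that the
  eigenspaces of \<open>Z\<^sup>T Z\<close> exhaust the space, so that \<open>\<sigma>\<^sub>r\<^sup>2\<close> is its least eigenvalue.
\<close>

section \<open>Rayleigh quotients\<close>

text \<open>For small \<open>t\<close> the linear term dominates; this serves as the first-order
  optimality condition below.\<close>

lemma quadratic_nonneg_linear_coeff_zero:
  fixes b c :: real
  assumes "\<And>t. 0 \<le> t * b + t\<^sup>2 * c"
  shows "b = 0"
proof (rule ccontr)
  assume b: "b \<noteq> 0"
  define k where "k = \<bar>c\<bar> + 1"
  have k: "k > 0" "c < k" by (auto simp: k_def)
  \<comment> \<open>The step \<open>- b / k\<close> is short enough for the linear decrease to beat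
    the quadratic term, as \<open>k\<close> exceeds \<open>c\<close>.\<close>
  have "0 \<le> (- b / k) * b + (- b / k)\<^sup>2 * c" by (rule assms)
  also have "\<dots> = b\<^sup>2 * (c - k) / k\<^sup>2"
    using k by (simp add: field_simps power2_eq_square)
  also have "\<dots> < 0"
    using k b by (simp add: divide_neg_pos mult_pos_neg)
  finally show False by simp
qed

text \<open>The minimum over the compact unit sphere of \<open>V\<close> is stationary. Since
  \<open>g\<close> may leave \<open>V\<close>, the eigenvector equation is stated weakly, tested
  against \<open>V\<close> only.\<close>

lemma rayleigh_minimizer:
  fixes g :: "'a::euclidean_space \<Rightarrow> 'a"
  assumes V: "subspace V" "u \<in> V" "u \<noteq> 0" and g: "linear g"
    and self: "\<And>x y. x \<in> V \<Longrightarrow> y \<in> V \<Longrightarrow> g x \<bullet> y = g y \<bullet> x"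
  obtains v l where "v \<in> V" "v \<noteq> 0"
    "\<And>w. w \<in> V \<Longrightarrow> g v \<bullet> w = l * (v \<bullet> w)"
    "\<And>w. w \<in> V \<Longrightarrow> l * (w \<bullet> w) \<le> g w \<bullet> w"
proof -
  let ?S = "V \<inter> sphere 0 1"
  interpret g: linear g by (rule g)
  have "compact ?S"
    using V by (simp add: closed_Int_compact closed_subspace)
  moreover have "continuous_on ?S (\<lambda>x. g x \<bullet> x)"
    using g by (intro continuous_intros linear_continuous_on) (simp add: linear_conv_bounded_linear)
  moreover have "u /\<^sub>R norm u \<in> ?S"
    using V by (simp add: subspace_scale)
  ultimately obtain v where v: "v \<in> ?S" and min: "\<And>x. x \<in> ?S \<Longrightarrow> g v \<bullet> v \<le> g x \<bullet> x"
    using continuous_attains_inf[of ?S "\<lambda>x. g x \<bullet> x"] by blast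
  define l where "l = g v \<bullet> v"
  have vv: "v \<bullet> v = 1" and vV: "v \<in> V" using v by (auto simp: dot_square_norm)
  have bound: "l * (w \<bullet> w) \<le> g w \<bullet> w" if w: "w \<in> V" for w
  proof (cases "w = 0")
    case False
    then have "l \<le> g (w /\<^sub>R norm w) \<bullet> (w /\<^sub>R norm w)"
      unfolding l_def using V w by (intro min) (simp add: subspace_scale)
    also have "\<dots> = (g w \<bullet> w) / (w \<bullet> w)"
      by (simp add: g.scale dot_square_norm power2_eq_square divide_simps)
    finally show ?thesis
      using False by (simp add: field_simps)
  qed (simp add: g.zero)
  have "g v \<bullet> w = l * (v \<bullet> w)" if w: "w \<in> V" for w
  proof -
    \<comment> \<open>This is \<open>bound\<close> at \<open>v + t w\<close>; its constant term
      vanishes because \<open>v\<close> attains \<open>l\<close>.\<close>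
    have "0 \<le> t * (2 * (g v \<bullet> w - l * (v \<bullet> w))) + t\<^sup>2 * (g w \<bullet> w - l * (w \<bullet> w))" for t
    proof -
      have "v + t *\<^sub>R w \<in> V" using V vV w by (simp add: subspace_add subspace_scale)
      from bound[OF this] show ?thesis
        using self[OF w vV] vv
        by (simp add: g.add g.scale inner_add_left inner_add_right l_def[symmetric]
            inner_commute[of w v] power2_eq_square algebra_simps)
    qed
    from quadratic_nonneg_linear_coeff_zero[OF this] show ?thesis by simp
  qed
  then show ?thesis using that[of v l] vV vv bound by fastforce
qed

section \<open>Singular values\<close>

lemma symmetric_matrix_self_adjoint:
  fixes A :: "real ^ 'n::finite ^ 'n"
  assumes "transpose A = A"
  shows "(A *v x) \<bullet> y = (A *v y) \<bullet> x"
  using assms by (metis dot_lmul_matrix inner_commute transpose_matrix_vector)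

lemma eigenspaces_orthogonal:
  fixes A :: "real ^ 'n::finite ^ 'n"
  assumes "transpose A = A" "A *v x = l *\<^sub>R x" "A *v y = m *\<^sub>R y" "l \<noteq> m"
  shows "x \<bullet> y = 0"
  using symmetric_matrix_self_adjoint[OF assms(1), of x y] assms(2-4)
  by (simp add: inner_commute)

text \<open>One eigenvector per eigenvalue gives an orthogonal, hence independent, family.\<close>

lemma finite_eigvals:
  fixes A :: "real ^ 'n::finite ^ 'n"
  assumes A: "transpose A = A"
  shows "finite (eigvals A)"
proof -
  have "\<forall>l\<in>eigvals A. \<exists>v. v \<noteq> 0 \<and> A *v v = l *\<^sub>R v" by (simp add: eigvals_def)
  then obtain f where f: "\<And>l. l \<in> eigvals A \<Longrightarrow> f l \<noteq> 0 \<and> A *v f l = l *\<^sub>R f l"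
    by metis
  have orth: "f l \<bullet> f m = 0" if "l \<in> eigvals A" "m \<in> eigvals A" "l \<noteq> m" for l m
    using eigenspaces_orthogonal[OF A] f that by blast
  have "pairwise orthogonal (f ` eigvals A)"
    unfolding pairwise_def orthogonal_def using orth by blast
  moreover have "0 \<notin> f ` eigvals A" using f by force
  ultimately have "finite (f ` eigvals A)"
    using pairwise_orthogonal_independent independent_imp_finite by blast
  moreover have "inj_on f (eigvals A)"
    using orth f by (metis inj_onI inner_eq_zero_iff)
  ultimately show ?thesis by (rule finite_imageD)
qed

lemma dim_Union_eigenspaces:
  fixes A :: "real ^ 'n::finite ^ 'n"
  assumes A: "transpose A = A" and "finite S"
  shows "dim (\<Union>l\<in>S. {v. A *v v = l *\<^sub>R v}) = (\<Sum>l\<in>S. dim {v. A *v v = l *\<^sub>R v})"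
  using \<open>finite S\<close>
proof induction
  case (insert l S)
  then have "dim ({v. A *v v = l *\<^sub>R v} \<union> (\<Union>l\<in>S. {v. A *v v = l *\<^sub>R v}))
      = dim {v. A *v v = l *\<^sub>R v} + dim (\<Union>l\<in>S. {v. A *v v = l *\<^sub>R v})"
    by (intro dim_orthogonal_sum) (use eigenspaces_orthogonal[OF A] in blast)
  with insert show ?case by simp
qed simp

text \<open>Otherwise the orthogonal complement of all eigenspaces is nonzero. A Rayleigh minimizer
  on it is an eigenvector, hence orthogonal to itself.\<close>

lemma symmetric_matrix_eigenspaces_full:
  fixes A :: "real ^ 'n::finite ^ 'n"
  assumes A: "transpose A = A"
  shows "(\<Sum>l\<in>eigvals A. dim {v. A *v v = l *\<^sub>R v}) = CARD('n)"
proof (rule ccontr)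
  let ?U = "\<Union>l\<in>eigvals A. {v. A *v v = l *\<^sub>R v}"
  assume "(\<Sum>l\<in>eigvals A. dim {v. A *v v = l *\<^sub>R v}) \<noteq> CARD('n)"
  then have "dim ?U < DIM(real ^ 'n)"
    using dim_subset_UNIV[of ?U] dim_Union_eigenspaces[OF A finite_eigvals[OF A]] by simp
  then obtain x where x: "x \<noteq> 0" "\<And>y. y \<in> span ?U \<Longrightarrow> orthogonal x y"
    using orthogonal_to_subspace_exists[of ?U] by blast
  define V where "V = {y. \<forall>z\<in>?U. orthogonal z y}"
  have V: "subspace V" unfolding V_def by (rule subspace_orthogonal_to_vectors)
  have "x \<in> V" unfolding V_def using x by (auto intro: span_base simp: orthogonal_commute)
  then obtain v l where v: "v \<in> V" "v \<noteq> 0" "\<And>w. w \<in> V \<Longrightarrow> (A *v v) \<bullet> w = l * (v \<bullet> w)"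
    using rayleigh_minimizer[OF V _ x(1) matrix_vector_mul_linear symmetric_matrix_self_adjoint[OF A]]
    by metis
  \<comment> \<open>\<open>V\<close> is invariant under \<open>A\<close>, so the weak equation can
    be tested on \<open>A *v v - l *\<^sub>R v\<close> itself.\<close>
  have "z \<bullet> (A *v v) = 0" if "z \<in> ?U" for z
  proof -
    obtain m where "A *v z = m *\<^sub>R z" using \<open>z \<in> ?U\<close> by blast
    moreover have "z \<bullet> v = 0" using v(1) that by (simp only: V_def orthogonal_def mem_Collect_eq)
    ultimately show ?thesis
      using symmetric_matrix_self_adjoint[OF A, of v z] by (simp add: inner_commute[of z "A *v v"])
  qed
  then have "A *v v \<in> V" unfolding V_def orthogonal_def by blast
  then have w: "A *v v - l *\<^sub>R v \<in> V" using V v(1) by (simp add: subspace_diff subspace_scale)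
  have "(A *v v - l *\<^sub>R v) \<bullet> (A *v v - l *\<^sub>R v) = 0"
    using v(3)[OF w] by (simp add: inner_diff_left)
  then have "A *v v = l *\<^sub>R v" by simp
  then have "v \<in> ?U" using v(2) by (auto simp: eigvals_def)
  then have "orthogonal v v" using v(1) unfolding V_def by blast
  then show False using v(2) by (simp add: orthogonal_self)
qed

text \<open>The size keeps the list index in \<open>sing_val\<close> within range.\<close>

lemma eigval_mset_symmetric:
  fixes A :: "real ^ 'n::finite ^ 'n"
  assumes A: "transpose A = A"
  shows "size (eigval_mset A) = CARD('n)" "set_mset (eigval_mset A) = eigvals A"
proof -
  have "size (eigval_mset A) = (\<Sum>l\<in>eigvals A. dim {v. A *v v = l *\<^sub>R v})"
    by (simp add: eigval_mset_def size_multiset_sum)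
  then show "size (eigval_mset A) = CARD('n)" by (simp add: symmetric_matrix_eigenspaces_full[OF A])
  have "dim {v. A *v v = l *\<^sub>R v} \<noteq> 0" if "l \<in> eigvals A" for l
    using that by (auto simp: eigvals_def)
  then show "set_mset (eigval_mset A) = eigvals A"
    by (auto simp: eigval_mset_def set_mset_sum[OF finite_eigvals[OF A]] set_mset_replicate_mset_subset
        split: if_splits)
qed

section \<open>Gram matrices and the smallest singular value\<close>

lemma gram_inner: "((transpose A ** A) *v v) \<bullet> w = (A *v v) \<bullet> (A *v w)"
  for A :: "real ^ 'r::finite ^ 'p::finite"
  by (metis dot_lmul_matrix matrix_vector_mul_assoc transpose_matrix_vector)

lemma transpose_gram: "transpose (transpose A ** A) = transpose A ** A"
  for A :: "real ^ 'r::finite ^ 'p::finite"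
  by (simp add: matrix_transpose_mul)

lemma eigvals_gram_nonneg:
  fixes A :: "real ^ 'r::finite ^ 'p::finite"
  assumes "l \<in> eigvals (transpose A ** A)"
  shows "0 \<le> l"
proof -
  obtain v where v: "v \<noteq> 0" "(transpose A ** A) *v v = l *\<^sub>R v"
    using assms by (auto simp: eigvals_def)
  then have "l * (v \<bullet> v) = (A *v v) \<bullet> (A *v v)"
    by (simp flip: gram_inner)
  then have "0 \<le> l * (v \<bullet> v)" by simp
  then show ?thesis using v(1) by (metis inner_gt_zero_iff mult_neg_pos not_less)
qed

lemma sing_val_eq_sqrt_eigval:
  fixes A :: "real ^ 'r::finite ^ 'p::finite"
  assumes "1 \<le> i" "i \<le> CARD('r)"
  obtains l where "l \<in> eigvals (transpose A ** A)" "sing_val i A = sqrt l"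
proof -
  let ?xs = "rev (sorted_list_of_multiset (eigval_mset (transpose A ** A)))"
  have "length ?xs = CARD('r)"
    by (metis eigval_mset_symmetric(1) length_rev mset_sorted_list_of_multiset size_mset transpose_gram)
  then have "?xs ! (i - 1) \<in> set ?xs" using assms by (intro nth_mem) simp
  then show ?thesis
    using that by (simp add: sing_val_def eigval_mset_symmetric(2)[OF transpose_gram])
qed

lemma sing_val_nonneg:
  fixes A :: "real ^ 'r::finite ^ 'p::finite"
  assumes "1 \<le> i" "i \<le> CARD('r)"
  shows "0 \<le> sing_val i A"
  using sing_val_eq_sqrt_eigval[OF assms] eigvals_gram_nonneg by (metis real_sqrt_ge_zero)

lemma sing_val_min_le_eigval:
  fixes A :: "real ^ 'r::finite ^ 'p::finite"
  assumes "l \<in> eigvals (transpose A ** A)"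
  shows "(sing_val_min A)\<^sup>2 \<le> l"
proof -
  define xs where "xs = sorted_list_of_multiset (eigval_mset (transpose A ** A))"
  have xs: "length xs = CARD('r)" "set xs = eigvals (transpose A ** A)" "sorted xs"
    unfolding xs_def
    by (metis eigval_mset_symmetric(1) mset_sorted_list_of_multiset size_mset transpose_gram,
        simp_all add: eigval_mset_symmetric(2)[OF transpose_gram])
  have pos: "0 < CARD('r)" by simp
  obtain i where "i < length xs" "l = xs ! i" using assms xs(2) by (metis in_set_conv_nth)
  then have "xs ! 0 \<le> l" using xs(3) by (simp add: sorted_nth_mono)
  moreover have "0 \<le> xs ! 0"
    using eigvals_gram_nonneg xs pos by (metis nth_mem)
  \<comment> \<open>Index \<open>CARD('r) - 1\<close> of the reversed list is the head of the
    ascending one.\<close>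
  moreover have "sing_val_min A = sqrt (xs ! 0)"
    using xs(1) pos by (simp add: sing_val_min_def sing_val_def rev_nth flip: xs_def)
  ultimately show ?thesis by simp
qed

text \<open>The minimum of the Rayleigh quotient of the Gram matrix is one of its
  eigenvalues.\<close>

lemma sing_val_min_le_norm:
  fixes A :: "real ^ 'r::finite ^ 'p::finite"
  shows "(sing_val_min A)\<^sup>2 * (norm v)\<^sup>2 \<le> (norm (A *v v))\<^sup>2"
proof -
  let ?G = "transpose A ** A"
  have "axis undefined 1 \<noteq> (0 :: real ^ 'r)" by (simp add: axis_eq_0_iff)
  then obtain u l where u: "u \<noteq> 0" "\<And>w. (?G *v u) \<bullet> w = l * (u \<bullet> w)"
    and l: "\<And>w. l * (w \<bullet> w) \<le> (?G *v w) \<bullet> w"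
    using rayleigh_minimizer[OF subspace_UNIV UNIV_I _ matrix_vector_mul_linear
        symmetric_matrix_self_adjoint[OF transpose_gram[of A]]] by (metis UNIV_I)
  have "?G *v u = l *\<^sub>R u"
    using u(2) by (metis inner_scaleR_left vector_eq_rdot)
  then have "(sing_val_min A)\<^sup>2 \<le> l"
    using u(1) by (intro sing_val_min_le_eigval) (auto simp: eigvals_def)
  then have "(sing_val_min A)\<^sup>2 * (v \<bullet> v) \<le> l * (v \<bullet> v)"
    by (rule mult_right_mono) simp
  with l[of v] show ?thesis by (simp add: gram_inner power2_norm_eq_inner)
qed

lemma sing_val_min_pos:
  fixes A :: "real ^ 'r::finite ^ 'p::finite"
  assumes "A \<in> full_col_rank"
  shows "0 < sing_val_min A"
proof -
  have pos: "1 \<le> CARD('r)" by (simp add: Suc_leI)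
  obtain l where l: "l \<in> eigvals (transpose A ** A)" "sing_val_min A = sqrt l"
    unfolding sing_val_min_def by (rule sing_val_eq_sqrt_eigval[OF pos order_refl])
  obtain v where v: "v \<noteq> 0" "(transpose A ** A) *v v = l *\<^sub>R v"
    using l(1) by (auto simp: eigvals_def)
  have "A *v v \<noteq> 0"
    using assms v(1) matrix_nonfull_linear_equations_eq[of A] by (auto simp: full_col_rank_def)
  then have "l * (v \<bullet> v) > 0"
    using v(2) gram_inner[of A v v] by simp
  then show ?thesis
    using l(2) v(1) by (metis inner_gt_zero_iff real_sqrt_gt_zero zero_less_mult_pos2)
qed

section \<open>Procrustes alignment\<close>

definition outer :: "real ^ 'n::finite \<Rightarrow> real ^ 'm::finite \<Rightarrow> real ^ 'm ^ 'n" where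
  "outer u v = (\<chi> i j. u $ i * v $ j)"

lemma inner_outer: "outer u v \<bullet> N = u \<bullet> (N *v v)"
  by (simp add: outer_def inner_vec_def matrix_vector_mult_def sum_distrib_left mult_ac)

lemma outer_mult_outer: "outer u v ** outer x y = (v \<bullet> x) *\<^sub>R outer u y"
  by (simp add: outer_def vec_eq_iff matrix_matrix_mult_def inner_vec_def
      sum_distrib_left sum_distrib_right mult_ac)

lemma transpose_outer: "transpose (outer u v) = outer v u"
  by (simp add: outer_def transpose_def vec_eq_iff)

text \<open>For \<open>u = 0\<close> this is the identity, so orthogonality holds for every
  \<open>u\<close>.\<close>

definition householder :: "real ^ 'n::finite \<Rightarrow> real ^ 'n ^ 'n" where
  "householder u = mat 1 - (2 / (u \<bullet> u)) *\<^sub>R outer u u"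

lemma householder_mult:
  "householder u ** householder v = mat 1 - (2 / (u \<bullet> u)) *\<^sub>R outer u u - (2 / (v \<bullet> v)) *\<^sub>R outer v v
    + (4 * (u \<bullet> v) / ((u \<bullet> u) * (v \<bullet> v))) *\<^sub>R outer u v"
  by (simp add: householder_def matrix_diff_distribs outer_mult_outer
      bounded_bilinear.scaleR_right[OF bounded_bilinear_matrix_mult]
      bounded_bilinear.scaleR_left[OF bounded_bilinear_matrix_mult] scaleR_diff_right mult.commute)

lemma orthogonal_matrix_householder: "orthogonal_matrix (householder u)"
proof -
  have "transpose (householder u) = householder u"
    by (simp add: householder_def transpose_diff linear_cmul[OF linear_transpose] transpose_outer)
  moreover have "householder u ** householder u = mat 1"
  proof (cases "u = 0")
    case False
    then show ?thesis
      by (simp add: householder_mult) (simp add: vec_eq_iff)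
  qed (simp add: householder_def)
  ultimately show ?thesis by (simp add: orthogonal_matrix)
qed

section \<open>Matrices whose pairing with orthogonal matrices is maximal at the identity\<close>

context
  fixes N :: "real ^ 'n::finite ^ 'n"
  assumes max: "\<And>R. orthogonal_matrix R \<Longrightarrow> R \<bullet> N \<le> mat 1 \<bullet> N"
begin

lemma maximal_trace_psd: "0 \<le> u \<bullet> (N *v u)"
proof (cases "u = 0")
  case False
  have "householder u \<bullet> N \<le> mat 1 \<bullet> N"
    by (rule max) (rule orthogonal_matrix_householder)
  then have "0 \<le> 2 / (u \<bullet> u) * (u \<bullet> (N *v u))"
    by (simp add: householder_def inner_diff_left inner_outer)
  moreover have "0 < 2 / (u \<bullet> u)" using False by simp
  ultimately show ?thesis by (metis mult_pos_neg not_less)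
qed simp

text \<open>A product of two reflections is a rotation in the plane of \<open>u\<close> and \<open>v\<close>.\<close>

lemma maximal_trace_rotation:
  assumes "u \<noteq> 0" "v \<noteq> 0"
  shows "2 * (u \<bullet> v) * (u \<bullet> (N *v v)) \<le> (v \<bullet> v) * (u \<bullet> (N *v u)) + (u \<bullet> u) * (v \<bullet> (N *v v))"
proof -
  have "(householder u ** householder v) \<bullet> N \<le> mat 1 \<bullet> N"
    by (intro max orthogonal_matrix_mul orthogonal_matrix_householder)
  then have "4 * (u \<bullet> v) / ((u \<bullet> u) * (v \<bullet> v)) * (u \<bullet> (N *v v))
      \<le> 2 / (u \<bullet> u) * (u \<bullet> (N *v u)) + 2 / (v \<bullet> v) * (v \<bullet> (N *v v))"
    by (simp add: householder_mult inner_diff_left inner_add_left inner_outer)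
  moreover have "0 < u \<bullet> u" "0 < v \<bullet> v" using assms by auto
  ultimately show ?thesis by (simp add: field_simps)
qed

text \<open>In the rotation inequality for \<open>axis i 1\<close> and
  \<open>axis i 1 + t *\<^sub>R axis j 1\<close> the constant terms cancel, so the linear
  coefficient \<open>N $ j $ i - N $ i $ j\<close> must vanish.\<close>

lemma maximal_trace_symmetric: "transpose N = N"
proof -
  have "N $ i $ j = N $ j $ i" if "i \<noteq> j" for i j
  proof -
    have "0 \<le> t * (N $ j $ i - N $ i $ j) + t\<^sup>2 * (N $ i $ i + N $ j $ j)" for t
    proof -
      let ?u = "axis i 1 :: real ^ 'n" and ?v = "axis i 1 + t *\<^sub>R axis j 1 :: real ^ 'n"
      have "?v $ i = 1" using that by (simp add: axis_def)
      then have "?v \<noteq> 0" by (metis zero_index zero_neq_one)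
      moreover have "?u \<noteq> 0" by (simp add: axis_eq_0_iff)
      ultimately have "2 * (?u \<bullet> ?v) * (?u \<bullet> (N *v ?v))
          \<le> (?v \<bullet> ?v) * (?u \<bullet> (N *v ?u)) + (?u \<bullet> ?u) * (?v \<bullet> (N *v ?v))"
        by (intro maximal_trace_rotation)
      moreover have "(axis i 1 :: real ^ 'n) $ j = 0" "(axis j 1 :: real ^ 'n) $ i = 0"
        using that by (auto simp: axis_def)
      ultimately show ?thesis
        by (simp add: inner_add_left inner_add_right inner_axis inner_axis' inner_axis_axis
            matrix_vector_right_distrib matrix_vector_mult_scaleR matrix_vector_mul_component
            power2_eq_square algebra_simps)
    qed
    from quadratic_nonneg_linear_coeff_zero[OF this] show ?thesis by simp
  qed
  then have "N $ j $ i = N $ i $ j" for i j by (cases "i = j") auto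
  then show ?thesis by (simp add: vec_eq_iff transpose_def)
qed

end

lemma inner_matrix_mult_left: "(A ** B) \<bullet> C = B \<bullet> (transpose A ** C)"
  for A :: "real ^ 'n::finite ^ 'm::finite" and B :: "real ^ 'k::finite ^ 'n"
proof -
  have "(A ** B) \<bullet> C = transpose (A ** B) \<bullet> transpose C" by (simp only: inner_transpose_transpose)
  also have "\<dots> = transpose B \<bullet> transpose (transpose A ** C)"
    by (simp add: matrix_transpose_mul inner_matrix_mult_right)
  finally show ?thesis by (simp only: inner_transpose_transpose)
qed

text \<open>Replacing \<open>Q\<close> by \<open>Q ** R\<close> cannot reduce the distance and
  preserves the norm of \<open>?Z\<close>; expanding the squares shows that the identity maximizes
  the pairing with \<open>?N\<close>.\<close>

lemma procrustes_alignment: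
  fixes Ys Y :: "real ^ 'r::finite ^ 'p::finite"
  assumes "is_arg_min (\<lambda>R. norm (Ys ** R - Y)) orthogonal_matrix Q"
  shows "transpose (transpose (Ys ** Q) ** Y) = transpose (Ys ** Q) ** Y"
    "0 \<le> u \<bullet> ((transpose (Ys ** Q) ** Y) *v u)"
proof -
  let ?Z = "Ys ** Q" let ?N = "transpose ?Z ** Y"
  have max: "R \<bullet> ?N \<le> mat 1 \<bullet> ?N" if R: "orthogonal_matrix R" for R
  proof -
    have "orthogonal_matrix (Q ** R)"
      using assms R by (simp add: is_arg_min_def orthogonal_matrix_mul)
    then have "norm (?Z - Y) \<le> norm (?Z ** R - Y)"
      using assms by (metis is_arg_min_linorder matrix_mul_assoc)
    then have "(norm (?Z - Y))\<^sup>2 \<le> (norm (?Z ** R - Y))\<^sup>2" by (simp add: power_mono)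
    moreover have "(?Z ** R) \<bullet> (?Z ** R) = ?Z \<bullet> ?Z"
      using norm_mult_orthogonal[OF R, of ?Z] by (simp add: norm_eq_sqrt_inner)
    ultimately have "(?Z ** R) \<bullet> Y \<le> ?Z \<bullet> Y"
      by (simp add: power2_norm_eq_inner inner_diff_left inner_diff_right
          inner_commute[of Y ?Z] inner_commute[of Y "?Z ** R"])
    then show ?thesis
      using inner_matrix_mult_left[of ?Z R Y] inner_matrix_mult_left[of ?Z "mat 1" Y] by simp
  qed
  show "transpose ?N = ?N" by (rule maximal_trace_symmetric[OF max])
  show "0 \<le> u \<bullet> (?N *v u)" by (rule maximal_trace_psd[OF max])
qed

section \<open>Comparison of \<open>Y Y\<^sup>T - Z Z\<^sup>T\<close> with \<open>Y - Z\<close>\<close>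

text \<open>Cyclicity of the trace; it moves pairings of \<open>p\<close> by \<open>p\<close>
  matrices to \<open>r\<close> by \<open>r\<close> ones.\<close>

lemma inner_mult_transpose:
  "(A ** transpose B) \<bullet> (C ** transpose D) = (transpose C ** A) \<bullet> (transpose D ** B)"
  for A C :: "real ^ 'n::finite ^ 'm::finite" and B D :: "real ^ 'n ^ 'k::finite"
proof -
  have "(A ** transpose B) \<bullet> (C ** transpose D) = (C ** (transpose D ** B)) \<bullet> A"
    by (simp add: inner_matrix_mult_right matrix_mul_assoc inner_commute)
  then show ?thesis by (metis inner_commute inner_matrix_mult_left)
qed

text \<open>Writing the pairing as quadratic forms on the rows of \<open>A\<close> lets pointwise
  bounds on \<open>M\<close> carry over.\<close>

lemma inner_gram: "(transpose A ** A) \<bullet> M = (\<Sum>i\<in>UNIV. A $ i \<bullet> (M *v A $ i))"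
  for A :: "real ^ 'r::finite ^ 'p::finite"
proof -
  have "(A ** M) $ i = A $ i v* M" for i
    by (simp add: vec_eq_iff matrix_matrix_mult_def vector_matrix_mult_def mult.commute)
  then have "A \<bullet> (A ** M) = (\<Sum>i\<in>UNIV. A $ i \<bullet> (M *v A $ i))"
    by (simp add: inner_vec_def[of A] dot_lmul_matrix[symmetric] inner_commute)
  then show ?thesis by (simp add: inner_matrix_mult_left)
qed

context
  fixes Y Z \<theta> :: "real ^ 'r::finite ^ 'p::finite"
  assumes \<theta>: "\<theta> = Y - Z"
    and sym: "transpose (transpose Z ** Y) = transpose Z ** Y"
    and psd: "\<And>u. 0 \<le> u \<bullet> ((transpose Z ** Y) *v u)"
begin

lemma transpose_mult_theta: "transpose \<theta> ** Z = transpose Z ** \<theta>" "transpose \<theta> ** Y = transpose Y ** \<theta>"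
  using sym by (simp_all add: \<theta> transpose_diff matrix_diff_distribs matrix_transpose_mul)

lemma gram_difference_eq:
  "Y ** transpose Y - Z ** transpose Z = Z ** transpose \<theta> + \<theta> ** transpose Z + \<theta> ** transpose \<theta>"
  by (simp add: \<theta> transpose_diff matrix_diff_distribs)

lemma norm_gram_difference:
  "(norm (Y ** transpose Y - Z ** transpose Z))\<^sup>2 =
    (transpose \<theta> ** \<theta>) \<bullet> (transpose \<theta> ** \<theta>) + 4 * ((transpose \<theta> ** \<theta>) \<bullet> (transpose \<theta> ** Z))
    + 2 * ((transpose \<theta> ** Z) \<bullet> (transpose \<theta> ** Z)) + 2 * ((transpose \<theta> ** \<theta>) \<bullet> (transpose Z ** Z))"
  unfolding gram_difference_eq power2_norm_eq_inner
  by (simp add: inner_add_left inner_add_right inner_mult_transpose transpose_mult_theta inner_commute)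

lemma inner_gram_theta_nonneg:
  "0 \<le> (transpose \<theta> ** \<theta>) \<bullet> (transpose \<theta> ** Z) + (transpose \<theta> ** \<theta>) \<bullet> (transpose Z ** Z)"
proof -
  have "transpose \<theta> ** Z + transpose Z ** Z = transpose Z ** Y"
    unfolding transpose_mult_theta(1) by (simp add: \<theta> matrix_diff_distribs)
  then have "(transpose \<theta> ** \<theta>) \<bullet> (transpose \<theta> ** Z) + (transpose \<theta> ** \<theta>) \<bullet> (transpose Z ** Z)
      = (transpose \<theta> ** \<theta>) \<bullet> (transpose Z ** Y)"
    by (metis inner_add_right)
  also have "\<dots> \<ge> 0" by (simp only: inner_gram sum_nonneg psd)
  finally show ?thesis .
qed

lemma gram_theta_le:
  "(norm (\<theta> ** transpose \<theta>))\<^sup>2 \<le> 2 * (norm (Y ** transpose Y - Z ** transpose Z))\<^sup>2"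
proof -
  define E where "E = transpose \<theta> ** \<theta>"
  define P where "P = transpose \<theta> ** Z"
  have "0 \<le> (E + 2 *\<^sub>R P) \<bullet> (E + 2 *\<^sub>R P) + 4 * (E \<bullet> P + E \<bullet> (transpose Z ** Z))"
    using inner_gram_theta_nonneg unfolding E_def P_def
    by (intro add_nonneg_nonneg inner_ge_zero) simp
  moreover have "(norm (\<theta> ** transpose \<theta>))\<^sup>2 = E \<bullet> E"
    by (simp add: E_def power2_norm_eq_inner inner_mult_transpose)
  ultimately show ?thesis
    unfolding norm_gram_difference
    by (simp add: inner_add_left inner_add_right inner_commute[of P E] flip: E_def P_def)
qed

lemma gram_difference_ge:
  assumes s: "\<And>v. s * (norm v)\<^sup>2 \<le> (norm (Z *v v))\<^sup>2"
  shows "2 * (sqrt 2 - 1) * s * (norm \<theta>)\<^sup>2 \<le> (norm (Y ** transpose Y - Z ** transpose Z))\<^sup>2"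
proof -
  define E where "E = transpose \<theta> ** \<theta>"
  define P where "P = transpose \<theta> ** Z"
  define B where "B = transpose Z ** Z"
  have "\<theta> $ i \<bullet> (B *v \<theta> $ i) = (norm (Z *v \<theta> $ i))\<^sup>2" for i
    using gram_inner[of Z "\<theta> $ i" "\<theta> $ i"] by (simp add: B_def power2_norm_eq_inner inner_commute)
  then have EB_eq: "E \<bullet> B = (\<Sum>i\<in>UNIV. (norm (Z *v \<theta> $ i))\<^sup>2)"
    unfolding E_def inner_gram by simp
  have "s * (norm \<theta>)\<^sup>2 = (\<Sum>i\<in>UNIV. s * (norm (\<theta> $ i))\<^sup>2)"
    by (simp add: power2_norm_eq_inner inner_vec_def[of \<theta>] sum_distrib_left)
  also have "\<dots> \<le> (\<Sum>i\<in>UNIV. (norm (Z *v \<theta> $ i))\<^sup>2)" by (intro sum_mono s)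
  also have "\<dots> = E \<bullet> B"
    by (rule EB_eq[symmetric])
  finally have EB: "2 * (sqrt 2 - 1) * (s * (norm \<theta>)\<^sup>2) \<le> 2 * (sqrt 2 - 1) * (E \<bullet> B)"
    by (intro mult_left_mono) simp_all
  have "0 \<le> 4 - 2 * sqrt 2" by (simp add: real_le_lsqrt)
  moreover have "0 \<le> E \<bullet> P + E \<bullet> B"
    using inner_gram_theta_nonneg unfolding E_def P_def B_def .
  \<comment> \<open>The factor \<open>sqrt 2\<close> reproduces \<open>2 * (P \<bullet> P)\<close>.
    The missing \<open>4 - 2 * sqrt 2\<close> of \<open>E \<bullet> P\<close> is paired with as much
    of \<open>E \<bullet> B\<close>, leaving \<open>2 - (4 - 2 * sqrt 2) = 2 * (sqrt 2 - 1)\<close>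
    of the latter.\<close>
  ultimately have "0 \<le> (E + sqrt 2 *\<^sub>R P) \<bullet> (E + sqrt 2 *\<^sub>R P) + (4 - 2 * sqrt 2) * (E \<bullet> P + E \<bullet> B)"
    by (metis add_nonneg_nonneg inner_ge_zero mult_nonneg_nonneg)
  also have "\<dots> = E \<bullet> E + 4 * (E \<bullet> P) + 2 * (P \<bullet> P) + 2 * (E \<bullet> B) - 2 * (sqrt 2 - 1) * (E \<bullet> B)"
    by (simp add: inner_add_left inner_add_right inner_commute[of P E] algebra_simps)
  finally show ?thesis
    using EB unfolding norm_gram_difference E_def[symmetric] P_def[symmetric] B_def[symmetric] mult.assoc
    by linarith
qed

end

section \<open>The Hessian form\<close>

text \<open>Against horizontal vectors the projection in \<open>lifted_hess\<close> is invisible, so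
  the Rayleigh principle applies to the unprojected derivative \<open>g\<close>.\<close>

lemma hess_negative_eigenvalue:
  fixes Y :: "real ^ 'r::finite ^ 'p::finite"
  assumes X: "transpose X = X" and \<theta>: "\<theta> \<in> horizontal Y" and neg: "hess_form (H_fun X) Y \<theta> \<theta> < 0"
  shows "\<exists>l<0. hess_eigenvalue (H_fun X) Y l"
proof -
  let ?V = "horizontal Y"
  define g where "g = frechet_derivative (lifted_grad (H_fun X)) (at Y)"
  have V: "subspace ?V" by (rule subspace_horizontal)
  have "lifted_grad (H_fun X) = (\<lambda>Z :: real ^ 'r ^ 'p. 2 *\<^sub>R ((Z ** transpose Z - X) ** Z))"
    by (rule ext) (rule lifted_grad_H_fun[OF X])
  moreover have "(\<lambda>Z :: real ^ 'r ^ 'p. Z ** transpose Z - X) differentiable (at Y)"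
    using has_derivative_gram[of Y] by (intro differentiable_diff) (auto simp: differentiable_def)
  then have "(\<lambda>Z :: real ^ 'r ^ 'p. 2 *\<^sub>R ((Z ** transpose Z - X) ** Z)) differentiable (at Y)"
    using bounded_bilinear.FDERIV[OF bounded_bilinear_matrix_mult _ has_derivative_ident]
      has_derivative_scaleR_right unfolding differentiable_def by blast
  ultimately have lin: "linear g"
    unfolding g_def by (simp add: frechet_derivative_works has_derivative_linear)
  have g: "g x \<bullet> y = hess_form (H_fun X) Y x y" if "y \<in> ?V" for x y
    by (simp add: hess_form_def lifted_hess_def g_def closest_point_subspace_inner[OF V that])
  have "g x \<bullet> y = g y \<bullet> x" if "x \<in> ?V" "y \<in> ?V" for x y
  proof -
    let ?S = "Y ** transpose Y - X"
    have "?S \<bullet> (x ** transpose y) = ?S \<bullet> (y ** transpose x)"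
      using inner_transpose_transpose[of ?S "x ** transpose y"]
      by (simp add: transpose_diff matrix_transpose_mul X)
    then show ?thesis
      unfolding g[OF that(1)] g[OF that(2)] hess_form_H_fun[OF X that(1)] hess_form_H_fun[OF X that(2)]
      by (simp add: inner_commute)
  qed
  moreover have "\<theta> \<noteq> 0" using neg by (auto simp: hess_form_def)
  ultimately obtain v l where v: "v \<in> ?V" "v \<noteq> 0" "\<And>w. w \<in> ?V \<Longrightarrow> g v \<bullet> w = l * (v \<bullet> w)"
    and l: "\<And>w. w \<in> ?V \<Longrightarrow> l * (w \<bullet> w) \<le> g w \<bullet> w"
    using rayleigh_minimizer[OF V \<theta> _ lin] by metis
  have "lifted_hess (H_fun X) Y v \<in> ?V"
    unfolding lifted_hess_def
    using V by (intro closest_point_in_set) (auto simp: closed_subspace dest: subspace_0)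
  then have d: "lifted_hess (H_fun X) Y v - l *\<^sub>R v \<in> ?V" (is "?d \<in> _")
    using V v(1) by (simp add: subspace_diff subspace_scale)
  \<comment> \<open>The projected Hessian is horizontal, so the residual \<open>?d\<close> is an
    admissible test vector.\<close>
  have "?d \<bullet> ?d = 0"
    using v(3)[OF d] g[OF d, of v] unfolding hess_form_def by (simp add: inner_diff_left)
  then have "hess_eigenvalue (H_fun X) Y l"
    unfolding hess_eigenvalue_def using v(1,2) by auto
  moreover have "l < 0"
  proof -
    have "l * (\<theta> \<bullet> \<theta>) < 0" using l[OF \<theta>] neg g[OF \<theta>] by simp
    then show ?thesis using inner_ge_zero[of \<theta>] by (auto simp: mult_less_0_iff)
  qed
  ultimately show ?thesis by blast
qed

text \<open>Both sides are expanded in \<open>D\<close> and \<open>F\<close>; the bound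
  \<open>F \<bullet> F \<le> 2 * (D \<bullet> D)\<close> turns three negative copies of
  \<open>D \<bullet> D\<close> into one.\<close>

lemma hess_form_alignment_error_le:
  fixes Y Z \<theta> :: "real ^ 'r::finite ^ 'p::finite"
  assumes \<theta>: "\<theta> = Y - Z"
    and sym: "transpose (transpose Z ** Y) = transpose Z ** Y"
    and psd: "\<And>u. 0 \<le> u \<bullet> ((transpose Z ** Y) *v u)"
    and X: "X = Z ** transpose Z"
  shows "\<theta> \<in> horizontal Y"
    "hess_form (H_fun X) Y \<theta> \<theta> \<le> 4 * (lifted_grad (H_fun X) Y \<bullet> \<theta>) - (norm (Y ** transpose Y - X))\<^sup>2"
proof -
  note tr = transpose_mult_theta[OF \<theta> sym psd]
  have Xt: "transpose X = X" by (simp add: X matrix_transpose_mul)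
  show hor: "\<theta> \<in> horizontal Y"
    by (simp add: horizontal_def matrix_transpose_mul tr)
  define D where "D = Y ** transpose Y - X"
  define F where "F = \<theta> ** transpose \<theta>"
  have Dt: "transpose D = D" by (simp add: D_def transpose_diff matrix_transpose_mul Xt)
  have T: "Y ** transpose \<theta> + \<theta> ** transpose Y = D + F"
    by (simp add: D_def F_def X \<theta> transpose_diff matrix_diff_distribs)
  have grad: "lifted_grad (H_fun X) Y \<bullet> \<theta> = D \<bullet> (D + F)"
    using inner_symmetrized[OF Dt, of Y \<theta>] unfolding T
    by (simp add: lifted_grad_H_fun[OF Xt] D_def)
  have "F \<bullet> F \<le> 2 * (D \<bullet> D)"
    using gram_theta_le[OF \<theta> sym psd] by (simp add: F_def D_def X power2_norm_eq_inner)
  moreover have "hess_form (H_fun X) Y \<theta> \<theta> = (D + F) \<bullet> (D + F) + 2 * (D \<bullet> F)"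
    unfolding hess_form_H_fun_diag[OF Xt hor] T power2_norm_eq_inner by (simp add: D_def F_def)
  ultimately show "hess_form (H_fun X) Y \<theta> \<theta>
      \<le> 4 * (lifted_grad (H_fun X) Y \<bullet> \<theta>) - (norm (Y ** transpose Y - X))\<^sup>2"
    unfolding grad D_def[symmetric] power2_norm_eq_inner
    by (simp add: inner_add_left inner_add_right inner_commute[of F D])
qed

theorem theorem10:
  fixes Ys Y \<theta> :: "real ^ 'r::finite ^ 'p::finite"
    and Xs :: "real ^ 'p ^ 'p"
    and Q :: "real ^ 'r ^ 'r"
    and \<mu> \<alpha> \<beta> \<gamma> :: real
  assumes "CARD('r) \<le> CARD('p)"
    and "Ys \<in> full_col_rank"
    and "Xs = Ys ** transpose Ys"
    and "0 \<le> \<mu>" "0 \<le> \<alpha>" "0 \<le> \<beta>" "0 \<le> \<gamma>"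
    and "Y \<in> region_R2 \<mu> \<alpha> \<beta> \<gamma> Ys"
    and "is_arg_min (\<lambda>R. norm (Ys ** R - Y)) orthogonal_matrix Q"
    and "\<theta> = Y - Ys ** Q"
  shows "\<theta> \<in> horizontal Y \<and>
    hess_form (H_fun Xs) Y \<theta> \<theta>
      \<le> (\<alpha> - 2 * (sqrt 2 - 1)) * (sing_val_min Ys)\<^sup>2 * (norm \<theta>)\<^sup>2 \<and>
    (\<alpha> < 2 * (sqrt 2 - 1) \<longrightarrow>
      (\<exists>l<0. hess_eigenvalue (H_fun Xs) Y l) \<and> escaping_direction (H_fun Xs) Y \<theta>)"
proof -
  let ?Z = "Ys ** Q"
  define s where "s = sing_val_min Ys"
  define k where "k = cond_num Ys"
  have s: "0 < s" unfolding s_def by (rule sing_val_min_pos) fact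
  have k: "0 \<le> k"
    unfolding k_def cond_num_def
    using s by (intro divide_nonneg_nonneg sing_val_nonneg) (simp_all add: s_def Suc_leI)
  have Q: "orthogonal_matrix Q" using assms(9) by (simp add: is_arg_min_def)
  note sym = procrustes_alignment(1)[OF assms(9)] and psd = procrustes_alignment(2)[OF assms(9)]
  have Xs: "Xs = ?Z ** transpose ?Z"
    using Q unfolding assms(3) orthogonal_matrix_def
    by (metis matrix_mul_assoc matrix_mul_rid matrix_transpose_mul)
  then have Xt: "transpose Xs = Xs" by (simp add: matrix_transpose_mul)
  note hess = hess_form_alignment_error_le[OF assms(10) sym psd Xs]
  have nQ: "norm (Q *v v) = norm v" for v
    using Q orthogonal_transformation_matrix[of "(*v) Q"]
    by (simp add: orthogonal_transformation)
  \<comment> \<open>An orthogonal \<open>Q\<close> preserves norms, so the lower bound for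
    \<open>Ys\<close> passes to \<open>?Z\<close>.\<close>
  have "s\<^sup>2 * (norm v)\<^sup>2 \<le> (norm (?Z *v v))\<^sup>2" for v
    using sing_val_min_le_norm[of Ys "Q *v v"] by (simp add: nQ s_def matrix_vector_mul_assoc)
  from gram_difference_ge[OF assms(10) sym psd this]
  have D: "2 * (sqrt 2 - 1) * s\<^sup>2 * (norm \<theta>)\<^sup>2 \<le> (norm (Y ** transpose Y - Xs))\<^sup>2"
    by (simp add: Xs)
  have "quot_dist (quot_class Y) (quot_class Ys) = norm \<theta>"
    unfolding quot_dist_class assms(10) norm_minus_commute[of Y]
    using assms(9) by (intro cInf_eq_minimum) (auto simp: is_arg_min_linorder)
  then have R: "\<mu> * s / k < norm \<theta>" "norm (lifted_grad (H_fun Xs) Y) \<le> \<alpha> * \<mu> * s ^ 3 / (4 * k)"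
    using assms(8) by (simp_all add: region_R2_def s_def k_def assms(3))
  have "4 * (lifted_grad (H_fun Xs) Y \<bullet> \<theta>) \<le> 4 * (norm (lifted_grad (H_fun Xs) Y) * norm \<theta>)"
    by (intro mult_left_mono norm_cauchy_schwarz) simp
  also have "\<dots> \<le> 4 * (\<alpha> * \<mu> * s ^ 3 / (4 * k) * norm \<theta>)"
    using R(2) by (intro mult_left_mono mult_right_mono) simp_all
  \<comment> \<open>The factor \<open>\<mu> * s / k\<close> is split off because the distance
    condition bounds it by \<open>norm \<theta>\<close>.\<close>
  also have "\<dots> = \<alpha> * s\<^sup>2 * norm \<theta> * (\<mu> * s / k)"
    by (simp add: power2_eq_square power3_eq_cube)
  also have "\<dots> \<le> \<alpha> * s\<^sup>2 * norm \<theta> * norm \<theta>"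
    using R(1) assms(5) by (intro mult_left_mono) simp_all
  finally have bound: "hess_form (H_fun Xs) Y \<theta> \<theta> \<le> (\<alpha> - 2 * (sqrt 2 - 1)) * s\<^sup>2 * (norm \<theta>)\<^sup>2"
    using hess(2) D by (simp add: power2_eq_square algebra_simps)
  have "hess_form (H_fun Xs) Y \<theta> \<theta> < 0" if "\<alpha> < 2 * (sqrt 2 - 1)"
  proof -
    \<comment> \<open>The strict distance condition makes \<theta> nonzero, hence the bound strictly
      negative.\<close>
    have "0 \<le> \<mu> * s / k" using assms(4) s k by simp
    then have "0 < norm \<theta>" using R(1) by linarith
    then have "(\<alpha> - 2 * (sqrt 2 - 1)) * (s\<^sup>2 * (norm \<theta>)\<^sup>2) < 0"
      using that s by (intro mult_neg_pos mult_pos_pos zero_less_power) linarith+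
    then show ?thesis using bound by (simp add: mult.assoc)
  qed
  then show ?thesis
    using hess(1) bound hess_negative_eigenvalue[OF Xt hess(1)]
    by (auto simp: escaping_direction_def s_def)
qed

end
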